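(* Let $k\ge 1$ and let $(\phi,\mathbf{B})$ be a QCSP instance with $\mathbf{B}$ a finite structure. There exists a $k$-constraint system for $(\phi,\mathbf{B})$ if and only if $(\phi,\mathbf{B})$ is $k$-judge-consistent.
   Context: Multi-sorted relational first-order logic: structures $\mathbf{B}$ have sort universes $B_s$ and relations $R^{\mathbf{B}}$; variables have sorts $s(v)$; a "map $f:V\to B$" sends each $v\in V$ into $B_{s(v)}$; $f\upharpoonright U$ is restriction and $f[y\to b]$ the extension mapping $y$ to $b$ (extended elementwise to sets of maps). $\mathbf{B}$ is finite if every $B_s$ is finite. A qc-formula is built from atoms, conjunction (arbitrary finite arity), $\forall,\exists$; $\mathrm{free}(\phi)$ is its free variables; a QCSP instance $(\phi,\mathbf{B})$ consists of a qc-sentence and a structure of the same signature. $I_\phi$ has one index per subformula occurrence of $\phi$ (node of its syntax tree), $\phi(i)$ is the subformula at $i$, parent/child refer to the tree. Judgements: a judgement is $(i,V,F)$ with $i\in I_\phi$, $V\subseteq\mathrm{free}(\phi(i))$ a set of variables, $F$ a set of maps $V\to B$ (exactly one map $\emptyset\to B$ exists); it is empty if $F=\emptyset$; its width is $|V|$. $F_1\Join F_2=\{f:U_1\cup U_2\to B: f\upharpoonright U_1\in F_1,f\upharpoonright U_2\in F_2\}$; for $y\in U$, $\epsilon_yF=\{f:U\setminus\{y\}\to B: f[y\to b]\in F$ for all $b\in B_{s(y)}\}$. A judgement proof is a finite sequence of judgements each of one of the types: (atom) $(i,\{v_1,\dots,v_k\},F)$ with $\phi(i)=R(v_1,\dots,v_k)$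 and $F=\{f:(f(v_1),\dots,f(v_k))\in R^{\mathbf{B}}\}$; (projection) $(i,U,F\upharpoonright U)$ from previous $(i,V,F)$, $U\subseteq V$; (join) $(i,U_1\cup U_2,F_1\Join F_2)$ from previous $(i,U_1,F_1),(i,U_2,F_2)$; (upward flow) $(i,V,F)$ from previous $(j,V,F)$, $i$ the parent of $j$; ($\forall$-elimination) $(i,V\setminus\{y\},\epsilon_yF)$ from previous $(j,V,F)$ with $y\in V$, $\phi(i)=\forall y\,\phi(j)$, $i$ parent of $j$; (downward flow) $(j,V,F)$ from previous $(i,V,F)$, $i$ parent of $j$. Its width is the maximum width of its judgements. $(\phi,\mathbf{B})$ is $k$-judge-consistent if no judgement proof of width at most $k$ contains an empty judgement. A $k$-constraint system $P$ for $(\phi,\mathbf{B})$ assigns to each $i\in I_\phi$ and each $V\subseteq\mathrm{free}(\phi(i))$ with $|V|\le k$ a non-empty set $P[i,V]$ of maps $V\to B$ such that: ($\alpha$) if $\phi(i)$ is an atom $R(v_1,\dots,v_m)$ and $V=\{v_1,\dots,v_m\}$ then $P[i,V]\subseteq\{f:(f(v_1),\dots,f(v_m))\in R^{\mathbf{B}}\}$; ($\pi$) if $U\subseteq V$ then $P[i,U]=P[i,V]\upharpoonright U$; ($\lambda$) if $j$ is a child of $i$ and $V\subseteq\mathrm{free}(\phi(j))$ then $P[i,V]=P[j,V]$; ($\epsilon$) if $j$ is a child of $i$, $\phi(i)=\forall y\,\phi(j)$, $U\subseteq\mathrm{free}(\phi(j))$ with $|U|\le k$ and $y\in U$, and $V=U\setminus\{y\}$,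 then $P[i,V]\subseteq\epsilon_y(P[j,U])$.
   Formalization: The universes B_s of the structure are assumed non-empty (the usual first-order convention); with an empty sort the equivalence can fail, e.g. for ∃u∃v∃w R(u,v,w) with k=1. *)

theory Defs
  imports Main "HOL-Library.FuncSet"
begin

text \<open>
  A multi-sorted relational signature has the elements of type \<open>'s\<close> as sorts, the elements of
  type \<open>'r\<close> as relation symbols, and is given by the arity function \<open>ar :: 'r \<Rightarrow> 's list\<close>.
  Variables are the elements of \<open>'v\<close>; the function \<open>srt :: 'v \<Rightarrow> 's\<close> gives the sort of a variable.
\<close>

datatype ('r, 'v) qc =
    Atom 'r "'v list"
  | Conj "('r, 'v) qc list"
  | Forall 'v "('r, 'v) qc"
  | Exists 'v "('r, 'v) qc"

fun free_vars :: "('r, 'v) qc \<Rightarrow> 'v set" where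
  "free_vars (Atom R vs) = set vs"
| "free_vars (Conj fs) = (\<Union>f\<in>set fs. free_vars f)"
| "free_vars (Forall y f) = free_vars f - {y}"
| "free_vars (Exists y f) = free_vars f - {y}"

fun well_sorted :: "('v \<Rightarrow> 's) \<Rightarrow> ('r \<Rightarrow> 's list) \<Rightarrow> ('r, 'v) qc \<Rightarrow> bool" where
  "well_sorted srt ar (Atom R vs) \<longleftrightarrow> map srt vs = ar R"
| "well_sorted srt ar (Conj fs) \<longleftrightarrow> (\<forall>f\<in>set fs. well_sorted srt ar f)"
| "well_sorted srt ar (Forall y f) \<longleftrightarrow> well_sorted srt ar f"
| "well_sorted srt ar (Exists y f) \<longleftrightarrow> well_sorted srt ar f"

definition qc_sentence :: "('v \<Rightarrow> 's) \<Rightarrow> ('r \<Rightarrow> 's list) \<Rightarrow> ('r, 'v) qc \<Rightarrow> bool" where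
  "qc_sentence srt ar \<phi> \<longleftrightarrow> well_sorted srt ar \<phi> \<and> free_vars \<phi> = {}"

record ('s, 'r, 'b) struct =
  univ :: "'s \<Rightarrow> 'b set"
  rel :: "'r \<Rightarrow> 'b list set"

text \<open>As usual in first-order logic, the universe of every sort is non-empty.\<close>

definition is_struct :: "('r \<Rightarrow> 's list) \<Rightarrow> ('s, 'r, 'b) struct \<Rightarrow> bool" where
  "is_struct ar B \<longleftrightarrow>
     (\<forall>s. univ B s \<noteq> {}) \<and>
     (\<forall>R. \<forall>t\<in>rel B R. list_all2 (\<lambda>b s. b \<in> univ B s) t (ar R))"

definition finite_struct :: "('s, 'r, 'b) struct \<Rightarrow> bool" where
  "finite_struct B \<longleftrightarrow> (\<forall>s. finite (univ B s))"

definition qcsp_instance ::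
    "('v \<Rightarrow> 's) \<Rightarrow> ('r \<Rightarrow> 's list) \<Rightarrow> ('r, 'v) qc \<Rightarrow> ('s, 'r, 'b) struct \<Rightarrow> bool" where
  "qcsp_instance srt ar \<phi> B \<longleftrightarrow> qc_sentence srt ar \<phi> \<and> is_struct ar B"

text \<open>
  Subformula occurrences are addressed by paths from the root of the syntax tree.  The value of
  \<open>subformula \<phi> i\<close> is only meaningful for \<open>i \<in> indices \<phi>\<close>.
\<close>

fun children :: "('r, 'v) qc \<Rightarrow> ('r, 'v) qc list" where
  "children (Atom R vs) = []"
| "children (Conj fs) = fs"
| "children (Forall y f) = [f]"
| "children (Exists y f) = [f]"

fun is_index :: "('r, 'v) qc \<Rightarrow> nat list \<Rightarrow> bool" where
  "is_index \<phi> [] \<longleftrightarrow> True"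
| "is_index \<phi> (n # p) \<longleftrightarrow> n < length (children \<phi>) \<and> is_index (children \<phi> ! n) p"

definition indices :: "('r, 'v) qc \<Rightarrow> nat list set" where
  "indices \<phi> = {i. is_index \<phi> i}"

fun subformula :: "('r, 'v) qc \<Rightarrow> nat list \<Rightarrow> ('r, 'v) qc" where
  "subformula \<phi> [] = \<phi>"
| "subformula \<phi> (n # p) = subformula (children \<phi> ! n) p"

definition parent_of :: "('r, 'v) qc \<Rightarrow> nat list \<Rightarrow> nat list \<Rightarrow> bool" where
  "parent_of \<phi> i j \<longleftrightarrow> i \<in> indices \<phi> \<and> j \<in> indices \<phi> \<and> (\<exists>n. j = i @ [n])"

text \<open>Maps defined on a set \<open>V\<close> of variables are extensional functions, with value
  \<open>undefined\<close> outside \<open>V\<close>.\<close>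

definition maps :: "('v \<Rightarrow> 's) \<Rightarrow> ('s, 'r, 'b) struct \<Rightarrow> 'v set \<Rightarrow> ('v \<Rightarrow> 'b) set" where
  "maps srt B V = (\<Pi>\<^sub>E v\<in>V. univ B (srt v))"

definition restrict_maps :: "('v \<Rightarrow> 'b) set \<Rightarrow> 'v set \<Rightarrow> ('v \<Rightarrow> 'b) set" where
  "restrict_maps F U = (\<lambda>f. restrict f U) ` F"

definition atom_maps ::
    "('v \<Rightarrow> 's) \<Rightarrow> ('s, 'r, 'b) struct \<Rightarrow> 'r \<Rightarrow> 'v list \<Rightarrow> ('v \<Rightarrow> 'b) set" where
  "atom_maps srt B R vs = {f \<in> maps srt B (set vs). map f vs \<in> rel B R}"

definition join_maps ::
    "('v \<Rightarrow> 's) \<Rightarrow> ('s, 'r, 'b) struct \<Rightarrow> 'v set \<Rightarrow> ('v \<Rightarrow> 'b) set \<Rightarrow> 'v set \<Rightarrow> ('v \<Rightarrow> 'b) set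
      \<Rightarrow> ('v \<Rightarrow> 'b) set" where
  "join_maps srt B U\<^sub>1 F\<^sub>1 U\<^sub>2 F\<^sub>2 =
     {f \<in> maps srt B (U\<^sub>1 \<union> U\<^sub>2). restrict f U\<^sub>1 \<in> F\<^sub>1 \<and> restrict f U\<^sub>2 \<in> F\<^sub>2}"

definition elim_maps ::
    "('v \<Rightarrow> 's) \<Rightarrow> ('s, 'r, 'b) struct \<Rightarrow> 'v \<Rightarrow> 'v set \<Rightarrow> ('v \<Rightarrow> 'b) set \<Rightarrow> ('v \<Rightarrow> 'b) set" where
  "elim_maps srt B y U F =
     {f \<in> maps srt B (U - {y}). \<forall>b\<in>univ B (srt y). f(y := b) \<in> F}"

type_synonym ('v, 'b) judgement = "nat list \<times> 'v set \<times> ('v \<Rightarrow> 'b) set"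

definition is_judgement ::
    "('v \<Rightarrow> 's) \<Rightarrow> ('r, 'v) qc \<Rightarrow> ('s, 'r, 'b) struct \<Rightarrow> ('v, 'b) judgement \<Rightarrow> bool" where
  "is_judgement srt \<phi> B = (\<lambda>(i, V, F).
     i \<in> indices \<phi> \<and> V \<subseteq> free_vars (subformula \<phi> i) \<and> F \<subseteq> maps srt B V)"

definition empty_judgement :: "('v, 'b) judgement \<Rightarrow> bool" where
  "empty_judgement = (\<lambda>(i, V, F). F = {})"

definition width :: "('v, 'b) judgement \<Rightarrow> nat" where
  "width = (\<lambda>(i, V, F). card V)"

text \<open>\<open>inference srt \<phi> B J c\<close>: one of the rules yields \<open>c\<close> from judgements in \<open>J\<close>.  That \<open>c\<close> is a
  judgement (in particular the restriction on its variables in the flow rules) is demanded in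
  \<open>judgement_proof\<close>.\<close>

inductive inference ::
    "('v \<Rightarrow> 's) \<Rightarrow> ('r, 'v) qc \<Rightarrow> ('s, 'r, 'b) struct \<Rightarrow> ('v, 'b) judgement set
      \<Rightarrow> ('v, 'b) judgement \<Rightarrow> bool"
  for srt :: "'v \<Rightarrow> 's" and \<phi> :: "('r, 'v) qc" and B :: "('s, 'r, 'b) struct"
    and J :: "('v, 'b) judgement set"
where
  atom: "i \<in> indices \<phi> \<Longrightarrow> subformula \<phi> i = Atom R vs
    \<Longrightarrow> inference srt \<phi> B J (i, set vs, atom_maps srt B R vs)"
| projection: "(i, V, F) \<in> J \<Longrightarrow> U \<subseteq> V
    \<Longrightarrow> inference srt \<phi> B J (i, U, restrict_maps F U)"
| join: "(i, U\<^sub>1, F\<^sub>1) \<in> J \<Longrightarrow> (i, U\<^sub>2, F\<^sub>2) \<in> J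
    \<Longrightarrow> inference srt \<phi> B J (i, U\<^sub>1 \<union> U\<^sub>2, join_maps srt B U\<^sub>1 F\<^sub>1 U\<^sub>2 F\<^sub>2)"
| upward_flow: "(j, V, F) \<in> J \<Longrightarrow> parent_of \<phi> i j
    \<Longrightarrow> inference srt \<phi> B J (i, V, F)"
| forall_elim: "(j, V, F) \<in> J \<Longrightarrow> y \<in> V \<Longrightarrow> parent_of \<phi> i j
    \<Longrightarrow> subformula \<phi> i = Forall y (subformula \<phi> j)
    \<Longrightarrow> inference srt \<phi> B J (i, V - {y}, elim_maps srt B y V F)"
| downward_flow: "(i, V, F) \<in> J \<Longrightarrow> parent_of \<phi> i j
    \<Longrightarrow> inference srt \<phi> B J (j, V, F)"

definition judgement_proof ::
    "('v \<Rightarrow> 's) \<Rightarrow> ('r, 'v) qc \<Rightarrow> ('s, 'r, 'b) struct \<Rightarrow> ('v, 'b) judgement list \<Rightarrow> bool" where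
  "judgement_proof srt \<phi> B js \<longleftrightarrow>
     (\<forall>n<length js. is_judgement srt \<phi> B (js ! n) \<and> inference srt \<phi> B (set (take n js)) (js ! n))"

text \<open>The inserted \<open>0\<close> only matters for the empty sequence.\<close>

definition proof_width :: "('v, 'b) judgement list \<Rightarrow> nat" where
  "proof_width js = Max (insert 0 (width ` set js))"

definition judge_consistent ::
    "nat \<Rightarrow> ('v \<Rightarrow> 's) \<Rightarrow> ('r, 'v) qc \<Rightarrow> ('s, 'r, 'b) struct \<Rightarrow> bool" where
  "judge_consistent k srt \<phi> B \<longleftrightarrow>
     \<not> (\<exists>js. judgement_proof srt \<phi> B js \<and> proof_width js \<le> k \<and> (\<exists>c\<in>set js. empty_judgement c))"

text \<open>The values \<open>P i V\<close> are unconstrained unless \<open>i\<close> is an index and \<open>V\<close> is a set of at most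
  \<open>k\<close> free variables of the subformula at \<open>i\<close>.\<close>

definition constraint_system ::
    "nat \<Rightarrow> ('v \<Rightarrow> 's) \<Rightarrow> ('r, 'v) qc \<Rightarrow> ('s, 'r, 'b) struct
      \<Rightarrow> (nat list \<Rightarrow> 'v set \<Rightarrow> ('v \<Rightarrow> 'b) set) \<Rightarrow> bool" where
  "constraint_system k srt \<phi> B P \<longleftrightarrow>
     (\<forall>i\<in>indices \<phi>. \<forall>V. V \<subseteq> free_vars (subformula \<phi> i) \<and> card V \<le> k \<longrightarrow>
        P i V \<noteq> {} \<and> P i V \<subseteq> maps srt B V) \<and>
     \<comment> \<open>\<open>\<alpha>\<close>\<close>
     (\<forall>i\<in>indices \<phi>. \<forall>R vs. subformula \<phi> i = Atom R vs \<and> card (set vs) \<le> k \<longrightarrow>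
        P i (set vs) \<subseteq> atom_maps srt B R vs) \<and>
     \<comment> \<open>\<open>\<pi>\<close>\<close>
     (\<forall>i\<in>indices \<phi>. \<forall>U V. V \<subseteq> free_vars (subformula \<phi> i) \<and> card V \<le> k \<and> U \<subseteq> V \<longrightarrow>
        P i U = restrict_maps (P i V) U) \<and>
     \<comment> \<open>\<open>\<lambda>\<close>\<close>
     (\<forall>i j V. parent_of \<phi> i j \<and> V \<subseteq> free_vars (subformula \<phi> i) \<and>
        V \<subseteq> free_vars (subformula \<phi> j) \<and> card V \<le> k \<longrightarrow>
        P i V = P j V) \<and>
     \<comment> \<open>\<open>\<epsilon>\<close>\<close>
     (\<forall>i j y U. parent_of \<phi> i j \<and> subformula \<phi> i = Forall y (subformula \<phi> j) \<and>
        U \<subseteq> free_vars (subformula \<phi> j) \<and> card U \<le> k \<and> y \<in> U \<longrightarrow>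
        P i (U - {y}) \<subseteq> elim_maps srt B y U (P j U))"

end

theory Submission imports Defs begin

text \<open>
  A constraint system lies below every judgement derivable in width \<open>k\<close>, so its non-emptiness
  excludes empty judgements.  Conversely, let \<open>P i V\<close> consist of the maps on \<open>V\<close> that satisfy every
  derivable judgement \<open>(i, U, F)\<close> with \<open>U \<subseteq> V\<close>.  Judgements on proper subsets of \<open>V\<close> have to be
  included because nothing at all need be derivable on \<open>V\<close> itself (for instance if all atoms have
  more than \<open>k\<close> variables).  By finiteness and closure under joins, \<open>P i V\<close> is either the set of all
  maps or the cylinder over a single derivable judgement; non-emptiness and the projection property
  reduce to that judgement, and the remaining properties are closure under the other rules.
\<close>

section \<open>Maps, finite intersections and sequences of inferences\<close>

lemma finite_free_vars: "finite (free_vars \<phi>)"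
  by (induction \<phi>) auto

lemma restrict_in_maps: "f \<in> maps srt B V \<Longrightarrow> U \<subseteq> V \<Longrightarrow> restrict f U \<in> maps srt B U"
  unfolding maps_def by (auto simp: PiE_iff)

lemma restrict_maps_id: "f \<in> maps srt B V \<Longrightarrow> restrict f V = f"
  unfolding maps_def by (rule PiE_restrict)

text \<open>Serves to merge all cylinders over derivable judgements into a single one. An empty
  family is excluded because \<open>\<Inter>{}\<close> is \<open>UNIV\<close>.\<close>

lemma finite_Inter_closed:
  assumes "finite A" "A \<noteq> {}" "A \<subseteq> C" "\<And>X Y. X \<in> C \<Longrightarrow> Y \<in> C \<Longrightarrow> X \<inter> Y \<in> C"
  shows "\<Inter>A \<in> C"
  using assms(1-3) by (induction A rule: finite_ne_induct) (auto intro: assms(4))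

lemma judgement_proof_Nil: "judgement_proof srt \<phi> B []"
  by (simp add: judgement_proof_def)

lemma inference_mono: "inference srt \<phi> B J c \<Longrightarrow> J \<subseteq> J' \<Longrightarrow> inference srt \<phi> B J' c"
  by (induction rule: inference.induct) (auto intro: inference.intros)

text \<open>Each rule has at most two premises. This leads from inferences over the possibly
  infinite set of derivable judgements back to finite proofs.\<close>

lemma inference_finite:
  "inference srt \<phi> B J c \<Longrightarrow> \<exists>A. finite A \<and> A \<subseteq> J \<and> inference srt \<phi> B A c"
proof (induction rule: inference.induct)
  case (atom i R vs)
  then show ?case by (intro exI[of _ "{}"]) (auto intro: inference.atom)
next
  case (projection i V F U)
  then show ?case by (intro exI[of _ "{(i, V, F)}"]) (auto intro: inference.projection)
next
  case (join i U\<^sub>1 F\<^sub>1 U\<^sub>2 F\<^sub>2)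
  then show ?case by (intro exI[of _ "{(i, U\<^sub>1, F\<^sub>1), (i, U\<^sub>2, F\<^sub>2)}"]) (auto intro: inference.join)
next
  case (upward_flow j V F i)
  then show ?case by (intro exI[of _ "{(j, V, F)}"]) (auto intro: inference.upward_flow)
next
  case (forall_elim j V F y i)
  then show ?case by (intro exI[of _ "{(j, V, F)}"]) (auto intro: inference.forall_elim)
next
  case (downward_flow i V F j)
  then show ?case by (intro exI[of _ "{(i, V, F)}"]) (auto intro: inference.downward_flow)
qed

text \<open>Putting \<open>xs\<close> in front only enlarges the set of judgements available to each
  member of \<open>ys\<close>, and inference is monotone in that set.\<close>

lemma judgement_proof_append:
  assumes "judgement_proof srt \<phi> B xs" "judgement_proof srt \<phi> B ys"
  shows "judgement_proof srt \<phi> B (xs @ ys)"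
  unfolding judgement_proof_def
proof (intro allI impI)
  fix n assume n: "n < length (xs @ ys)"
  show "is_judgement srt \<phi> B ((xs @ ys) ! n) \<and>
      inference srt \<phi> B (set (take n (xs @ ys))) ((xs @ ys) ! n)"
  proof (cases "n < length xs")
    case True
    then show ?thesis using assms(1) by (simp add: judgement_proof_def nth_append)
  next
    case False
    with n have "n - length xs < length ys" by auto
    with assms(2) have "is_judgement srt \<phi> B (ys ! (n - length xs))"
      "inference srt \<phi> B (set (take (n - length xs) ys)) (ys ! (n - length xs))"
      by (auto simp: judgement_proof_def)
    then show ?thesis using False
      by (auto simp: nth_append intro: inference_mono)
  qed
qed

lemma judgement_proof_snoc:
  assumes "judgement_proof srt \<phi> B xs" "is_judgement srt \<phi> B c" "inference srt \<phi> B (set xs) c"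
  shows "judgement_proof srt \<phi> B (xs @ [c])"
  using assms by (auto simp: judgement_proof_def nth_append less_Suc_eq)

lemma proof_width_le_iff: "proof_width js \<le> k \<longleftrightarrow> (\<forall>c\<in>set js. width c \<le> k)"
  by (simp add: proof_width_def)

section \<open>Derivable judgements and their closure under the rules\<close>

definition derivable ::
    "nat \<Rightarrow> ('v \<Rightarrow> 's) \<Rightarrow> ('r, 'v) qc \<Rightarrow> ('s, 'r, 'b) struct \<Rightarrow> ('v, 'b) judgement set" where
  "derivable k srt \<phi> B = {c. \<exists>js. judgement_proof srt \<phi> B js \<and> proof_width js \<le> k \<and> c \<in> set js}"

lemma judge_consistent_iff:
  "judge_consistent k srt \<phi> B \<longleftrightarrow> (\<forall>(i, V, F)\<in>derivable k srt \<phi> B. F \<noteq> {})"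
  by (auto simp: judge_consistent_def derivable_def empty_judgement_def)

lemma derivableD:
  assumes "c \<in> derivable k srt \<phi> B"
  shows "is_judgement srt \<phi> B c" "width c \<le> k"
proof -
  from assms obtain js where "judgement_proof srt \<phi> B js" "proof_width js \<le> k" "c \<in> set js"
    by (auto simp: derivable_def)
  then show "is_judgement srt \<phi> B c" "width c \<le> k"
    by (auto simp: judgement_proof_def in_set_conv_nth) (auto simp: proof_width_le_iff)
qed

lemma derivable_judgement:
  assumes "(i, V, F) \<in> derivable k srt \<phi> B"
  shows "i \<in> indices \<phi>" "V \<subseteq> free_vars (subformula \<phi> i)" "F \<subseteq> maps srt B V" "card V \<le> k" "finite V"
  using derivableD[OF assms] finite_subset[OF _ finite_free_vars]
  by (auto simp: is_judgement_def width_def)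

text \<open>Proofs can be concatenated, and the width bound is a condition on each judgement
  separately, so it survives concatenation.\<close>

lemma finite_derivable_proof:
  assumes "finite A" "A \<subseteq> derivable k srt \<phi> B"
  shows "\<exists>js. judgement_proof srt \<phi> B js \<and> proof_width js \<le> k \<and> A \<subseteq> set js"
  using assms
proof (induction A rule: finite_induct)
  case empty
  show ?case by (intro exI[of _ "[]"]) (simp add: judgement_proof_Nil proof_width_def)
next
  case (insert c A)
  then obtain xs where "judgement_proof srt \<phi> B xs" "proof_width xs \<le> k" "A \<subseteq> set xs"
    by auto
  moreover from insert.prems obtain ys
    where "judgement_proof srt \<phi> B ys" "proof_width ys \<le> k" "c \<in> set ys"
    by (auto simp: derivable_def)
  ultimately show ?case
    by (intro exI[of _ "xs @ ys"]) (auto simp: proof_width_le_iff intro: judgement_proof_append)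
qed

text \<open>The finitely many premises occur in one common proof, to which \<open>c\<close> is
  appended. Each rule thereby becomes a closure property of \<open>derivable\<close>.\<close>

lemma derivable_closed:
  assumes "inference srt \<phi> B (derivable k srt \<phi> B) c" "is_judgement srt \<phi> B c" "width c \<le> k"
  shows "c \<in> derivable k srt \<phi> B"
proof -
  obtain A where A: "finite A" "A \<subseteq> derivable k srt \<phi> B" "inference srt \<phi> B A c"
    using inference_finite[OF assms(1)] by blast
  from finite_derivable_proof[OF A(1,2)] obtain js
    where js: "judgement_proof srt \<phi> B js" "proof_width js \<le> k" "A \<subseteq> set js" by blast
  have "judgement_proof srt \<phi> B (js @ [c])"
    using judgement_proof_snoc[OF js(1) assms(2) inference_mono[OF A(3) js(3)]] .
  moreover have "proof_width (js @ [c]) \<le> k"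
    using js(2) assms(3) by (auto simp: proof_width_le_iff)
  ultimately show ?thesis unfolding derivable_def by force
qed

section \<open>Constraint systems lie below derivable judgements\<close>

lemma constraint_system_below_derivable:
  assumes P: "constraint_system k srt \<phi> B P" and "(i, V, F) \<in> derivable k srt \<phi> B"
  shows "P i V \<subseteq> F"
proof -
  from P have alpha: "\<And>i R vs. i \<in> indices \<phi> \<Longrightarrow> subformula \<phi> i = Atom R vs \<Longrightarrow> card (set vs) \<le> k
        \<Longrightarrow> P i (set vs) \<subseteq> atom_maps srt B R vs"
    and maps: "\<And>i V. i \<in> indices \<phi> \<Longrightarrow> V \<subseteq> free_vars (subformula \<phi> i) \<Longrightarrow> card V \<le> k
        \<Longrightarrow> P i V \<subseteq> maps srt B V"
    and proj: "\<And>i U V. i \<in> indices \<phi> \<Longrightarrow> V \<subseteq> free_vars (subformula \<phi> i) \<Longrightarrow> card V \<le> k \<Longrightarrow> U \<subseteq> V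
        \<Longrightarrow> P i U = restrict_maps (P i V) U"
    and flow: "\<And>i j V. parent_of \<phi> i j \<Longrightarrow> V \<subseteq> free_vars (subformula \<phi> i)
        \<Longrightarrow> V \<subseteq> free_vars (subformula \<phi> j) \<Longrightarrow> card V \<le> k \<Longrightarrow> P i V = P j V"
    and elim: "\<And>i j y U. parent_of \<phi> i j \<Longrightarrow> subformula \<phi> i = Forall y (subformula \<phi> j)
        \<Longrightarrow> U \<subseteq> free_vars (subformula \<phi> j) \<Longrightarrow> card U \<le> k \<Longrightarrow> y \<in> U
        \<Longrightarrow> P i (U - {y}) \<subseteq> elim_maps srt B y U (P j U)"
    unfolding constraint_system_def by auto
  \<comment> \<open>A single rule preserves the inclusion. The premises are assumed derivable as
    well because this supplies the free-variable and width bounds under which the properties of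
    \<open>P\<close> apply to them.\<close>
  have step: "P i V \<subseteq> F"
    if inf: "inference srt \<phi> B J (i, V, F)"
      and J: "\<And>i V F. (i, V, F) \<in> J \<Longrightarrow> (i, V, F) \<in> derivable k srt \<phi> B \<and> P i V \<subseteq> F"
      and c: "i \<in> indices \<phi>" "V \<subseteq> free_vars (subformula \<phi> i)" "card V \<le> k" for J i V F
    using inf
  proof cases
    case (atom R vs)
    then show ?thesis using alpha c by auto
  next
    case (projection V' F')
    have "P i V' \<subseteq> F'" and d: "(i, V', F') \<in> derivable k srt \<phi> B"
      using J[OF projection(2)] by auto
    moreover have "P i V = restrict_maps (P i V') V"
      using proj derivable_judgement[OF d] projection(3) by blast
    ultimately show ?thesis using projection(1) by (auto simp: restrict_maps_def)
  next
    case (join U\<^sub>1 F\<^sub>1 U\<^sub>2 F\<^sub>2)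
    \<comment> \<open>By \<pi>, both restrictions of a map in \<open>P i V\<close> lie in the
      systems at the premises, hence in \<open>F\<^sub>1\<close> and
      \<open>F\<^sub>2\<close>.\<close>
    have "P i U\<^sub>1 = restrict_maps (P i V) U\<^sub>1" "P i U\<^sub>2 = restrict_maps (P i V) U\<^sub>2"
      using proj c join(1) by blast+
    then show ?thesis
      using J[OF join(3)] J[OF join(4)] maps[OF c] join(1,2)
      by (auto simp: restrict_maps_def join_maps_def)
  next
    case (upward_flow j)
    have d: "(j, V, F) \<in> derivable k srt \<phi> B" and "P j V \<subseteq> F"
      using J[OF upward_flow(1)] by auto
    then show ?thesis
      using flow[OF upward_flow(2) c(2) derivable_judgement(2)[OF d] c(3)] by simp
  next
    case (forall_elim j V' F' y)
    have d: "(j, V', F') \<in> derivable k srt \<phi> B" and "P j V' \<subseteq> F'"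
      using J[OF forall_elim(3)] by auto
    \<comment> \<open>\<open>elim_maps\<close> is monotone in its set of maps, so the bound from
      \<epsilon> passes from \<open>P j V'\<close> to \<open>F'\<close>.\<close>
    then have "elim_maps srt B y V' (P j V') \<subseteq> elim_maps srt B y V' F'"
      unfolding elim_maps_def by blast
    then show ?thesis
      using elim[OF forall_elim(5,6) derivable_judgement(2,4)[OF d] forall_elim(4)] forall_elim(1,2)
      by blast
  next
    case (downward_flow i')
    have d: "(i', V, F) \<in> derivable k srt \<phi> B" and "P i' V \<subseteq> F"
      using J[OF downward_flow(1)] by auto
    then show ?thesis
      using flow[OF downward_flow(2) derivable_judgement(2)[OF d] c(2,3)] by simp
  qed
  from assms(2) obtain js where js: "judgement_proof srt \<phi> B js" "proof_width js \<le> k"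
    and mem: "(i, V, F) \<in> set js"
    by (auto simp: derivable_def)
  \<comment> \<open>Strong induction on the position in the proof, for all \<open>i\<close>,
    \<open>V\<close> and \<open>F\<close> at once, since premises may sit at other nodes and on
    other variable sets.\<close>
  have "\<forall>i V F. js ! n = (i, V, F) \<longrightarrow> P i V \<subseteq> F" if "n < length js" for n
    using that
  proof (induction n rule: less_induct)
    case (less n)
    show ?case
    proof (intro allI impI)
      fix i V F assume eq: "js ! n = (i, V, F)"
      have "(i, V, F) \<in> derivable k srt \<phi> B"
        using js less.prems eq[symmetric] by (auto simp: derivable_def)
      note c = derivable_judgement[OF this]
      show "P i V \<subseteq> F"
      proof (rule step)
        show "inference srt \<phi> B (set (take n js)) (i, V, F)"
          using js(1) less.prems eq unfolding judgement_proof_def by metis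
        fix i' V' F' assume "(i', V', F') \<in> set (take n js)"
        then obtain m where m: "m < n" "js ! m = (i', V', F')"
          using less.prems by (auto simp: in_set_conv_nth)
        then have "(i', V', F') \<in> set js" using less.prems by (metis less_trans nth_mem)
        then show "(i', V', F') \<in> derivable k srt \<phi> B \<and> P i' V' \<subseteq> F'"
          using less.IH[OF m(1)] m less.prems js by (auto simp: derivable_def)
      qed (use c in auto)
    qed
  qed
  with mem show ?thesis by (metis in_set_conv_nth)
qed

section \<open>The canonical system as a single cylinder\<close>

definition cylinder ::
    "('v \<Rightarrow> 's) \<Rightarrow> ('s, 'r, 'b) struct \<Rightarrow> 'v set \<Rightarrow> 'v set \<Rightarrow> ('v \<Rightarrow> 'b) set \<Rightarrow> ('v \<Rightarrow> 'b) set" where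
  "cylinder srt B V U F = {f \<in> maps srt B V. restrict f U \<in> F}"

definition canonical_system ::
    "nat \<Rightarrow> ('v \<Rightarrow> 's) \<Rightarrow> ('r, 'v) qc \<Rightarrow> ('s, 'r, 'b) struct
      \<Rightarrow> nat list \<Rightarrow> 'v set \<Rightarrow> ('v \<Rightarrow> 'b) set" where
  "canonical_system k srt \<phi> B i V =
     {f \<in> maps srt B V. \<forall>U F. U \<subseteq> V \<and> (i, U, F) \<in> derivable k srt \<phi> B \<longrightarrow> restrict f U \<in> F}"

text \<open>Restricting in two stages is the same as restricting at once, so joins of judgements
  become intersections of cylinders.\<close>

lemma cylinder_join:
  assumes "U\<^sub>1 \<subseteq> V" "U\<^sub>2 \<subseteq> V"
  shows "cylinder srt B V (U\<^sub>1 \<union> U\<^sub>2) (join_maps srt B U\<^sub>1 F\<^sub>1 U\<^sub>2 F\<^sub>2) =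
    cylinder srt B V U\<^sub>1 F\<^sub>1 \<inter> cylinder srt B V U\<^sub>2 F\<^sub>2"
proof -
  have "(U\<^sub>1 \<union> U\<^sub>2) \<inter> U\<^sub>1 = U\<^sub>1" "(U\<^sub>1 \<union> U\<^sub>2) \<inter> U\<^sub>2 = U\<^sub>2" by auto
  then show ?thesis
    using assms by (auto simp: cylinder_def join_maps_def intro: restrict_in_maps)
qed

lemma derivable_projection:
  assumes "(i, V, F) \<in> derivable k srt \<phi> B" "U \<subseteq> V"
  shows "(i, U, restrict_maps F U) \<in> derivable k srt \<phi> B"
proof (rule derivable_closed)
  show "inference srt \<phi> B (derivable k srt \<phi> B) (i, U, restrict_maps F U)"
    using assms by (rule inference.projection)
  show "is_judgement srt \<phi> B (i, U, restrict_maps F U)"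
    using derivable_judgement[OF assms(1)] assms(2)
    by (auto simp: is_judgement_def restrict_maps_def intro!: restrict_in_maps)
  show "width (i, U, restrict_maps F U) \<le> k"
    using derivable_judgement[OF assms(1)] card_mono[OF _ assms(2)] by (auto simp: width_def)
qed

text \<open>A join can exceed width \<open>k\<close>, hence the bound on the union. It will hold
  because both sets lie in one \<open>V\<close> of size at most \<open>k\<close>.\<close>

lemma derivable_join:
  assumes "(i, U\<^sub>1, F\<^sub>1) \<in> derivable k srt \<phi> B" "(i, U\<^sub>2, F\<^sub>2) \<in> derivable k srt \<phi> B"
    and "card (U\<^sub>1 \<union> U\<^sub>2) \<le> k"
  shows "(i, U\<^sub>1 \<union> U\<^sub>2, join_maps srt B U\<^sub>1 F\<^sub>1 U\<^sub>2 F\<^sub>2) \<in> derivable k srt \<phi> B"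
  using assms(3) derivable_judgement[OF assms(1)] derivable_judgement[OF assms(2)]
  by (intro derivable_closed[OF inference.join[OF assms(1,2)]])
    (auto simp: is_judgement_def join_maps_def width_def)

text \<open>The two flow rules are inverse to each other; the inclusions for \<open>V\<close> make
  the triple meet the free-variable condition at both nodes.\<close>

lemma derivable_flow:
  assumes "parent_of \<phi> i j" "V \<subseteq> free_vars (subformula \<phi> i)" "V \<subseteq> free_vars (subformula \<phi> j)"
  shows "(i, V, F) \<in> derivable k srt \<phi> B \<longleftrightarrow> (j, V, F) \<in> derivable k srt \<phi> B"
proof
  assume *: "(i, V, F) \<in> derivable k srt \<phi> B"
  then show "(j, V, F) \<in> derivable k srt \<phi> B"
    using assms derivable_judgement[OF *] inference.downward_flow[OF * assms(1)]
    by (intro derivable_closed) (auto simp: is_judgement_def width_def parent_of_def)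
next
  assume *: "(j, V, F) \<in> derivable k srt \<phi> B"
  then show "(i, V, F) \<in> derivable k srt \<phi> B"
    using assms derivable_judgement[OF *] inference.upward_flow[OF * assms(1)]
    by (intro derivable_closed) (auto simp: is_judgement_def width_def parent_of_def)
qed

lemma derivable_forall_elim:
  assumes "(j, V, F) \<in> derivable k srt \<phi> B" "y \<in> V" "parent_of \<phi> i j"
    and "subformula \<phi> i = Forall y (subformula \<phi> j)"
  shows "(i, V - {y}, elim_maps srt B y V F) \<in> derivable k srt \<phi> B"
  using assms derivable_judgement[OF assms(1)]
  by (intro derivable_closed[OF inference.forall_elim[OF assms]])
    (auto simp: is_judgement_def width_def parent_of_def elim_maps_def)

lemma canonical_system_cases:
  assumes fin: "finite_struct B" and V: "finite V" "card V \<le> k"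
  obtains (all) "canonical_system k srt \<phi> B i V = maps srt B V"
  | (cylinder) U F where "U \<subseteq> V" "(i, U, F) \<in> derivable k srt \<phi> B"
      "canonical_system k srt \<phi> B i V = cylinder srt B V U F"
proof -
  define C where "C = {cylinder srt B V U F | U F. U \<subseteq> V \<and> (i, U, F) \<in> derivable k srt \<phi> B}"
  \<comment> \<open>Intersecting with \<open>maps srt B V\<close> makes an empty family
    \<open>C\<close> yield all maps rather than \<open>UNIV\<close>.\<close>
  have eq: "canonical_system k srt \<phi> B i V = maps srt B V \<inter> \<Inter>C"
    by (auto simp: canonical_system_def C_def cylinder_def)
  have sub: "C \<subseteq> Pow (maps srt B V)"
    by (auto simp: C_def cylinder_def)
  \<comment> \<open>Finiteness of the structure enters here: there are only finitely many cylinders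
    in \<open>V\<close>, even without a bound on the number of derivable judgements.\<close>
  have "finite (maps srt B V)"
    using fin V(1) unfolding maps_def finite_struct_def by (intro finite_PiE) auto
  then have "finite C" using sub by (meson finite_Pow_iff finite_subset)
  moreover have "X \<inter> Y \<in> C" if "X \<in> C" "Y \<in> C" for X Y
  proof -
    from that obtain U\<^sub>1 F\<^sub>1 U\<^sub>2 F\<^sub>2 where *: "U\<^sub>1 \<subseteq> V" "U\<^sub>2 \<subseteq> V"
      "(i, U\<^sub>1, F\<^sub>1) \<in> derivable k srt \<phi> B" "(i, U\<^sub>2, F\<^sub>2) \<in> derivable k srt \<phi> B"
      "X = cylinder srt B V U\<^sub>1 F\<^sub>1" "Y = cylinder srt B V U\<^sub>2 F\<^sub>2"
      by (auto simp: C_def)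
    have "card (U\<^sub>1 \<union> U\<^sub>2) \<le> k"
      using card_mono[OF V(1), of "U\<^sub>1 \<union> U\<^sub>2"] V(2) * by auto
    from derivable_join[OF *(3,4) this] cylinder_join[OF *(1,2)] *(1,2,5,6) show ?thesis
      unfolding C_def by (metis (mono_tags, lifting) Un_least mem_Collect_eq)
  qed
  ultimately have "\<Inter>C \<in> C" if "C \<noteq> {}"
    using that by (intro finite_Inter_closed) auto
  then consider "C = {}" | "\<Inter>C \<in> C" by auto
  then show thesis
  proof cases
    case 1
    with eq all show thesis by simp
  next
    case 2
    \<comment> \<open>As a member of \<open>C\<close>, the intersection already consists of maps on
      \<open>V\<close>, so the outer intersection with \<open>maps srt B V\<close>
      disappears.\<close>
    then have "canonical_system k srt \<phi> B i V \<in> C" using eq sub by (simp add: Int_absorb1 subset_iff)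
    with cylinder show thesis by (auto simp: C_def)
  qed
qed

section \<open>Extension and amalgamation of maps\<close>

lemma maps_nonempty: "is_struct ar B \<Longrightarrow> maps srt B V \<noteq> {}"
  by (auto simp: is_struct_def maps_def PiE_eq_empty_iff)

text \<open>All sorts are inhabited, so the values outside \<open>U\<close> can be taken from an
  arbitrary map \<open>d\<close> on \<open>V\<close>.\<close>

lemma maps_extend:
  assumes "is_struct ar B" "g \<in> maps srt B U" "U \<subseteq> V"
  obtains f where "f \<in> maps srt B V" "restrict f U = g"
proof -
  obtain d where d: "d \<in> maps srt B V" using maps_nonempty[OF assms(1)] by blast
  show thesis
  proof
    show "(\<lambda>v. if v \<in> U then g v else d v) \<in> maps srt B V"
      using d assms(2,3) by (auto simp: maps_def PiE_iff extensional_def)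
    show "restrict (\<lambda>v. if v \<in> U then g v else d v) U = g"
      using assms(2) by (auto simp: maps_def PiE_iff extensional_def restrict_def fun_eq_iff)
  qed
qed

text \<open>Maps that agree on their common domain glue to a map on \<open>U \<union> W\<close>,
  which then extends to \<open>V\<close>.\<close>

lemma maps_amalgamate:
  assumes "is_struct ar B" "g \<in> maps srt B U" "h \<in> maps srt B W" "U \<subseteq> V" "W \<subseteq> V"
    and agree: "restrict g (U \<inter> W) = restrict h (U \<inter> W)"
  obtains f where "f \<in> maps srt B V" "restrict f U = g" "restrict f W = h"
proof -
  have eq: "g v = h v" if "v \<in> U" "v \<in> W" for v
    using fun_cong[OF agree, of v] that by simp
  define e where "e = (\<lambda>v. if v \<in> U then g v else h v)"
  have "e \<in> maps srt B (U \<union> W)"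
    using assms(2,3) by (auto simp: e_def maps_def PiE_iff extensional_def)
  then obtain f where f: "f \<in> maps srt B V" "restrict f (U \<union> W) = e"
    using maps_extend[OF assms(1)] assms(4,5) by (metis Un_least)
  have fe: "f v = e v" if "v \<in> U \<union> W" for v
    using fun_cong[OF f(2), of v] that by simp
  have "restrict f U = g" "restrict f W = h"
    using assms(2,3) fe eq
    by (auto simp: e_def maps_def PiE_iff extensional_def restrict_def fun_eq_iff)
  with f(1) show thesis by (rule that)
qed

section \<open>The canonical system satisfies the defining properties\<close>

lemma canonical_system_subset_maps: "canonical_system k srt \<phi> B i V \<subseteq> maps srt B V"
  by (auto simp: canonical_system_def)

text \<open>Only one judgement has to be satisfied: consistency provides some \<open>g\<close> in
  its set of maps, and any extension of \<open>g\<close> to \<open>V\<close> lies in the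
  cylinder.\<close>

lemma canonical_system_nonempty:
  assumes "is_struct ar B" "finite_struct B" "finite V" "card V \<le> k" "judge_consistent k srt \<phi> B"
  shows "canonical_system k srt \<phi> B i V \<noteq> {}"
  using assms(2-4)
proof (cases rule: canonical_system_cases[where srt = srt and \<phi> = \<phi> and i = i])
  case all
  then show ?thesis using maps_nonempty[OF assms(1)] by metis
next
  case (cylinder U F)
  then obtain g where g: "g \<in> F" using assms(5) by (fastforce simp: judge_consistent_iff)
  then have "g \<in> maps srt B U" using derivable_judgement[OF cylinder(2)] by auto
  then obtain f where "f \<in> maps srt B V" "restrict f U = g"
    using maps_extend[OF assms(1)] cylinder(1) by metis
  then show ?thesis using cylinder(3) g by (auto simp: cylinder_def)
qed

lemma canonical_system_projection:
  assumes "is_struct ar B" "finite_struct B" "finite V" "card V \<le> k" "U \<subseteq> V"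
  shows "canonical_system k srt \<phi> B i U = restrict_maps (canonical_system k srt \<phi> B i V) U"
proof
  \<comment> \<open>The easy inclusion: a subset of \<open>U\<close> is a subset of
    \<open>V\<close>, so maps in the system on \<open>V\<close> already meet every condition imposed
    on \<open>U\<close>.\<close>
  show "restrict_maps (canonical_system k srt \<phi> B i V) U \<subseteq> canonical_system k srt \<phi> B i U"
    using assms(5)
    by (auto simp: canonical_system_def restrict_maps_def Int_absorb1 intro!: restrict_in_maps)
  show "canonical_system k srt \<phi> B i U \<subseteq> restrict_maps (canonical_system k srt \<phi> B i V) U"
  proof
    fix g assume g: "g \<in> canonical_system k srt \<phi> B i U"
    then have gm: "g \<in> maps srt B U" by (simp add: canonical_system_def)
    show "g \<in> restrict_maps (canonical_system k srt \<phi> B i V) U"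
      using assms(2-4)
    proof (cases rule: canonical_system_cases[where srt = srt and \<phi> = \<phi> and i = i])
      case all
      obtain f where "f \<in> maps srt B V" "restrict f U = g"
        using maps_extend[OF assms(1) gm assms(5)] .
      then show ?thesis using all by (auto simp: restrict_maps_def)
    next
      case (cylinder W F)
      \<comment> \<open>The judgement on \<open>W\<close> need not lie inside \<open>U\<close>, but
        its projection to \<open>U \<inter> W\<close> is derivable and does, so \<open>g\<close>
        satisfies it. The resulting \<open>h\<close> in \<open>F\<close> agrees with
        \<open>g\<close> on the overlap and can be amalgamated with it.\<close>
      have "restrict g (U \<inter> W) \<in> restrict_maps F (U \<inter> W)"
        using g derivable_projection[OF cylinder(2), of "U \<inter> W"]
        by (auto simp: canonical_system_def)
      then obtain h where h: "h \<in> F" "restrict g (U \<inter> W) = restrict h (U \<inter> W)"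
        by (auto simp: restrict_maps_def)
      then have "h \<in> maps srt B W" using derivable_judgement[OF cylinder(2)] by auto
      then obtain f where "f \<in> maps srt B V" "restrict f U = g" "restrict f W = h"
        using maps_amalgamate[OF assms(1) gm _ assms(5) cylinder(1) h(2)] by blast
      then show ?thesis using cylinder(3) h(1) by (auto simp: restrict_maps_def cylinder_def)
    qed
  qed
qed

text \<open>The atom rule gives a judgement on the full set \<open>set vs\<close>, and restricting a
  map to its own domain changes nothing.\<close>

lemma canonical_system_atom:
  assumes "i \<in> indices \<phi>" "subformula \<phi> i = Atom R vs" "card (set vs) \<le> k"
  shows "canonical_system k srt \<phi> B i (set vs) \<subseteq> atom_maps srt B R vs"
proof -
  have "(i, set vs, atom_maps srt B R vs) \<in> derivable k srt \<phi> B"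
    using assms
    by (intro derivable_closed inference.atom) (auto simp: is_judgement_def width_def atom_maps_def)
  then have "restrict f (set vs) \<in> atom_maps srt B R vs"
    if "f \<in> canonical_system k srt \<phi> B i (set vs)" for f
    using that by (simp add: canonical_system_def)
  moreover have "restrict f (set vs) = f"
    if "f \<in> canonical_system k srt \<phi> B i (set vs)" for f
    using that canonical_system_subset_maps by (intro restrict_maps_id) blast
  ultimately show ?thesis by auto
qed

lemma canonical_system_flow:
  assumes "parent_of \<phi> i j" "V \<subseteq> free_vars (subformula \<phi> i)" "V \<subseteq> free_vars (subformula \<phi> j)"
  shows "canonical_system k srt \<phi> B i V = canonical_system k srt \<phi> B j V"
proof -
  have "(i, U, F) \<in> derivable k srt \<phi> B \<longleftrightarrow> (j, U, F) \<in> derivable k srt \<phi> B" if "U \<subseteq> V" for U F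
    using derivable_flow[OF assms(1)] assms(2,3) that by blast
  then show ?thesis unfolding canonical_system_def by blast
qed

text \<open>A judgement at \<open>j\<close> that constrains \<open>f(y := b)\<close> is moved to the
  parent, where \<open>f\<close> satisfies it: by \<forall>-elimination if it mentions
  \<open>y\<close>, by upward flow otherwise.\<close>

lemma canonical_system_forall:
  assumes "parent_of \<phi> i j" "subformula \<phi> i = Forall y (subformula \<phi> j)"
    and "U \<subseteq> free_vars (subformula \<phi> j)" "y \<in> U"
  shows "canonical_system k srt \<phi> B i (U - {y}) \<subseteq>
    elim_maps srt B y U (canonical_system k srt \<phi> B j U)"
proof
  fix f assume f: "f \<in> canonical_system k srt \<phi> B i (U - {y})"
  then have fm: "f \<in> maps srt B (U - {y})" by (simp add: canonical_system_def)
  have "f(y := b) \<in> canonical_system k srt \<phi> B j U" if b: "b \<in> univ B (srt y)" for b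
    unfolding canonical_system_def mem_Collect_eq
  proof (intro conjI allI impI)
    show "f(y := b) \<in> maps srt B U"
      using fm b assms(4) by (auto simp: maps_def PiE_iff extensional_def)
    fix W F assume W: "W \<subseteq> U \<and> (j, W, F) \<in> derivable k srt \<phi> B"
    show "restrict (f(y := b)) W \<in> F"
    proof (cases "y \<in> W")
      case True
      have "(i, W - {y}, elim_maps srt B y W F) \<in> derivable k srt \<phi> B"
        using W True assms(1,2) by (intro derivable_forall_elim) auto
      then have "restrict f (W - {y}) \<in> elim_maps srt B y W F"
        using f W unfolding canonical_system_def by blast
      then have "(restrict f (W - {y}))(y := b) \<in> F"
        using b by (simp add: elim_maps_def)
      moreover have "(restrict f (W - {y}))(y := b) = restrict (f(y := b)) W"
        using True by (auto simp: restrict_def fun_eq_iff)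
      ultimately show ?thesis by simp
    next
      case False
      \<comment> \<open>The quantifier binds only \<open>y\<close>, so a set \<open>W\<close>
        avoiding \<open>y\<close> stays free at the parent and the flow is admissible.\<close>
      then have "W \<subseteq> free_vars (subformula \<phi> i)" "W \<subseteq> free_vars (subformula \<phi> j)"
        using W assms(2,3) by auto
      then have "(i, W, F) \<in> derivable k srt \<phi> B"
        using derivable_flow[OF assms(1)] W by blast
      then have "restrict f W \<in> F"
        using f W False unfolding canonical_system_def by blast
      moreover have "restrict f W = restrict (f(y := b)) W"
        using False by (auto simp: restrict_def fun_eq_iff)
      ultimately show ?thesis by simp
    qed
  qed
  with fm show "f \<in> elim_maps srt B y U (canonical_system k srt \<phi> B j U)"
    by (simp add: elim_maps_def)
qed

section \<open>Equivalence of constraint systems and judge-consistency\<close>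

theorem theorem5p3:
  fixes k :: nat
    and srt :: "'v \<Rightarrow> 's" and ar :: "'r \<Rightarrow> 's list"
    and \<phi> :: "('r, 'v) qc" and B :: "('s, 'r, 'b) struct"
  assumes "k \<ge> 1"
    and "qcsp_instance srt ar \<phi> B"
    and "finite_struct B"
  shows "(\<exists>P. constraint_system k srt \<phi> B P) \<longleftrightarrow> judge_consistent k srt \<phi> B"
proof
  assume "\<exists>P. constraint_system k srt \<phi> B P"
  then obtain P where P: "constraint_system k srt \<phi> B P" ..
  show "judge_consistent k srt \<phi> B"
    unfolding judge_consistent_iff
  proof clarify
    fix i V assume d: "(i, V, {}) \<in> derivable k srt \<phi> B"
    then have "P i V = {}" using constraint_system_below_derivable[OF P] by blast
    \<comment> \<open>Derivability of the judgement ensures that \<open>V\<close> is a set of free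
      variables of size at most \<open>k\<close>, where \<open>P\<close> must be non-empty.\<close>
    moreover have "P i V \<noteq> {}"
      using P derivable_judgement[OF d] by (simp add: constraint_system_def)
    ultimately show False by simp
  qed
next
  assume consistent: "judge_consistent k srt \<phi> B"
  have struct: "is_struct ar B" using assms(2) by (simp add: qcsp_instance_def)
  \<comment> \<open>Finiteness of \<open>V\<close> has to be supplied separately, since
    \<open>card V \<le> k\<close> also holds for infinite \<open>V\<close>.\<close>
  have fin: "finite V" if "V \<subseteq> free_vars (subformula \<phi> i)" for V i
    using that finite_free_vars finite_subset by blast
  have "constraint_system k srt \<phi> B (canonical_system k srt \<phi> B)"
    unfolding constraint_system_def
    by (intro conjI ballI allI impI canonical_system_subset_maps canonical_system_atom
        canonical_system_flow canonical_system_forall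
        canonical_system_nonempty[OF struct assms(3) _ _ consistent]
        canonical_system_projection[OF struct assms(3)]; elim conjE; (assumption | erule fin))
  then show "\<exists>P. constraint_system k srt \<phi> B P" by blast
qed

end
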